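(* Let the matrices $\bar A_s,\bar B^{\rm img}_{\bar a,s},\bar B_\xi,W_a,\bar V_a,P$ and $\bar P=P^\top P\succ 0$ be as defined in the context, let $Q\succ 0$, and let $\alpha\in(0,1)$ be given. Put $\bar B_s=\begin{bmatrix}\bar B^{\rm img}_{\bar a,s}&\bar B_\xi\end{bmatrix}$. Suppose there exist scalars $\alpha_1,\alpha_2$ and symmetric matrices $M,\bar M$ of size $s(n_x+n_c)$ such that $$\bar M=\frac{2-\alpha}{1-\alpha}M\succ 0,\qquad \alpha_1+\alpha_2\ge\alpha,\qquad 0\le\alpha_1\le 1,\qquad 0\le\alpha_2\le 1,$$ $$\begin{bmatrix}\alpha\bar M&0&\bar A_s^\top\bar M\\ 0&\bar\Omega&\bar B_s^\top\bar M\\ \bar M\bar A_s&\bar M\bar B_s&\bar M\end{bmatrix}\succeq 0,\qquad \bar\Omega={\rm diag}\left\{(1-\alpha_1)\bar V_a^\top W_a^\top\bar P W_a\bar V_a,\ (1-\alpha_2)Q\right\}.$$ Then the ellipsoid $\mathcal E^\infty=\{x:\ x^\top M x\le 1\}$ is a valid asymptotic outer approximation of the reachable set $\mathcal R_{\bar x^{\rm dev}_s}(k)$ as $k\to\infty$; that is, for every admissible trajectory $\bar x^{\rm dev}_s(\cdot)$ (as defined in the context, with arbitrary initial states) one has $\limsup_{k\to\infty}\bar x^{\rm dev}_s(k)^\top M\,\bar x^{\rm dev}_s(k)\le 1$.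
   Context: Plant and attack: $x(k+1)=Ax(k)+Bu^a(k)+B_dd(k)$, $y(k)=Cx(k)+D_dd(k)$, with $x\in\mathbb R^{n_x}$, $y\in\mathbb R^{n_y}$, $u^a\in\mathbb R^{n_u}$, $d\in\mathbb R^{n_d}$, $(A,C)$ observable and $(A,B)$ controllable. The attack $a(k)\in\mathbb R^{n_a}$, $n_a=n_u+n_y$, acts by $u^a=u+B_aa$, $y^a=y+D_aa$. The controller is $x_c(k+1)=A_cx_c(k)+B_c[y_{\rm ref}(k)-y^a(k)]$, $u(k)=C_cx_c(k)+D_c[y_{\rm ref}(k)-y^a(k)]$, $x_c\in\mathbb R^{n_c}$. The closed-loop matrices are $$\bar A=\begin{bmatrix}A-BD_cC&BC_c\\-B_cC&A_c\end{bmatrix},\quad \bar B_a=\begin{bmatrix}B(B_a-D_cD_a)\\-B_cD_a\end{bmatrix},\quad \bar B_d=\begin{bmatrix}B_d-BD_cD_d\\-B_cD_d\end{bmatrix}.$$ The state deviation caused by attack and disturbance obeys $\bar x^{\rm dev}(k+1)=\bar A\bar x^{\rm dev}(k)+\bar B_aa(k)+\bar B_dd(k)$. For a signal $z$, $z_s(k)=[z(k-s+1)^\top\cdots z(k)^\top]^\top$. Fix an order $s\ge n_x$; $\xi=d_s\in\mathbb R^{n_\xi}$, $n_\xi=sn_d$. Residual generator: $\Gamma_s=[C^\top\ (CA)^\top\cdots(CA^{s-1})^\top]^\top$; $\Gamma_s^\perp\in\mathbb R^{(sn_y-n_x)\times sn_y}$ has full row rank and satisfies $\Gamma_s^\perp\Gamma_s=0$.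 $H_{d,s}$ is the $s\times s$ block lower-triangular Toeplitz matrix with diagonal blocks $D_d$ and $(i,j)$ block $CA^{i-j-1}B_d$ for $i>j$; $H_{a,s}$ is the same with $(B_d,D_d)$ replaced by $(BB_a,D_a)$. $W_d=\Gamma_s^\perp H_{d,s}$, $W_a=\Gamma_s^\perp H_{a,s}$. The residual is $r=P(W_d\xi+W_aa_s)$ with design matrix $P$ and $\bar P=P^\top P\succ0$. It is assumed that $W_a$ has full row rank; $W_a^\dagger$ is its Moore-Penrose inverse. From a singular value decomposition $W_a=U_a\Lambda V_a^\top$ (singular values ordered with the nonzero ones first), $\bar V_a$ consists of the first $sn_y-n_x$ columns of $V_a$ and $\bar V_a^\perp$ of the remaining ones. Attacks are represented as $a_s=-W_a^\dagger W_d\xi+\bar V_a\bar a^{\rm img}_s+\bar V_a^\perp\bar a^{\rm ker}_s$. Lifted dynamics: $\bar A_s$ is the $s\times s$ block matrix whose last block column is $[\bar A^\top,(\bar A^2)^\top,\dots,(\bar A^s)^\top]^\top$ and whose other blocks are zero; $\bar B_{a,s}$ is the $s\times s$ block lower-triangular Toeplitz matrix with $(i,j)$ block $\bar A^{i-j}\bar B_a$ for $i\ge j$; $\bar B_{d,s}$ is the same with $\bar B_d$ in place of $\bar B_a$. $\bar B^{\rm img}_{\bar a,s}=\bar B_{a,s}\bar V_a$, $\bar B^{\rm ker}_{\bar a,s}=\bar B_{a,s}\bar V_a^\perp$, $\bar B_\xi=\bar B_{d,s}-\bar B_{a,s}W_a^\dagger W_d$. Admissible trajectory: sequences $\bar x_s^{\rm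 dev}(k)\in\mathbb R^{s(n_x+n_c)}$, $\bar a^{\rm img}_s(i)$, $\bar a^{\rm ker}_s(i)$, $\xi(i)$ such that for all $k\ge0$ $$\bar x^{\rm dev}_s(k+s)=\bar A_s\bar x^{\rm dev}_s(k)+\bar B^{\rm img}_{\bar a,s}\bar a^{\rm img}_s(k+s-1)+\bar B^{\rm ker}_{\bar a,s}\bar a^{\rm ker}_s(k+s-1)+\bar B_\xi\xi(k+s-1),$$ and for all $i\ge1$: $\bar a^{\rm ker}_s(i)=0$, $\|PW_a\bar V_a\bar a^{\rm img}_s(i)\|^2\le1$ (stealthiness), and $\xi(i)^\top Q\xi(i)\le1$. The reachable set $\mathcal R_{\bar x^{\rm dev}_s}(k)$ is the set of values $\bar x^{\rm dev}_s(k)$ so obtained, with the constraints imposed for $i=1,\dots,k$. *)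

theory Defs
  imports
    "Jordan_Normal_Form.DL_Rank"
    "HOL-Library.Extended_Real"
begin

definition symmetric_matrix :: "real mat \<Rightarrow> bool" where
  "symmetric_matrix A \<longleftrightarrow> square_mat A \<and> transpose_mat A = A"

definition pos_def :: "real mat \<Rightarrow> bool" where
  "pos_def A \<longleftrightarrow> symmetric_matrix A \<and>
     (\<forall>x \<in> carrier_vec (dim_row A). x \<noteq> 0\<^sub>v (dim_row A) \<longrightarrow> x \<bullet> (A *\<^sub>v x) > 0)"

definition pos_semidef :: "real mat \<Rightarrow> bool" where
  "pos_semidef A \<longleftrightarrow> symmetric_matrix A \<and>
     (\<forall>x \<in> carrier_vec (dim_row A). x \<bullet> (A *\<^sub>v x) \<ge> 0)"

text \<open>The rank in the library is the dimension of the column space; its first argument is the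
  dimension of the ambient space of the columns, i.e. the number of rows.\<close>

definition mat_rank :: "real mat \<Rightarrow> nat" where
  "mat_rank A = vec_space.rank (dim_row A) A"

definition full_row_rank :: "real mat \<Rightarrow> bool" where
  "full_row_rank A \<longleftrightarrow> mat_rank A = dim_row A"

definition moore_penrose_inverse :: "real mat \<Rightarrow> real mat \<Rightarrow> bool" where
  "moore_penrose_inverse A X \<longleftrightarrow>
     X \<in> carrier_mat (dim_col A) (dim_row A) \<and>
     A * X * A = A \<and> X * A * X = X \<and>
     transpose_mat (A * X) = A * X \<and> transpose_mat (X * A) = X * A"

text \<open>The predicate \<open>orthogonal_mat\<close> of the library asks only for pairwise orthogonal nonzero
  columns, hence the explicit orthonormality conditions.\<close>

definition is_svd :: "real mat \<Rightarrow> real mat \<Rightarrow> real mat \<Rightarrow> real mat \<Rightarrow> bool" where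
  "is_svd W U L V \<longleftrightarrow>
     U \<in> carrier_mat (dim_row W) (dim_row W) \<and>
     L \<in> carrier_mat (dim_row W) (dim_col W) \<and>
     V \<in> carrier_mat (dim_col W) (dim_col W) \<and>
     transpose_mat U * U = 1\<^sub>m (dim_row W) \<and>
     transpose_mat V * V = 1\<^sub>m (dim_col W) \<and>
     diagonal_mat L \<and>
     (\<forall>i < min (dim_row W) (dim_col W). L $$ (i, i) \<ge> 0) \<and>
     (\<forall>i < min (dim_row W) (dim_col W). \<forall>j < i. L $$ (i, i) \<noteq> 0 \<longrightarrow> L $$ (j, j) \<noteq> 0) \<and>
     W = U * L * transpose_mat V"

definition first_cols :: "nat \<Rightarrow> real mat \<Rightarrow> real mat" where
  "first_cols m V = mat (dim_row V) m (\<lambda>(i, j). V $$ (i, j))"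

definition remaining_cols :: "nat \<Rightarrow> real mat \<Rightarrow> real mat" where
  "remaining_cols m V = mat (dim_row V) (dim_col V - m) (\<lambda>(i, j). V $$ (i, j + m))"

text \<open>Horizontal concatenation, the counterpart of the library's \<open>@\<^sub>r\<close>.\<close>

definition append_cols :: "real mat \<Rightarrow> real mat \<Rightarrow> real mat" (infixr "@\<^sub>c" 66) where
  "A @\<^sub>c B = four_block_mat A B (0\<^sub>m 0 (dim_col A)) (0\<^sub>m 0 (dim_col B))"

text \<open>The matrix of \<open>p \<times> q\<close> blocks of size \<open>r \<times> c\<close>, the block in position \<open>(i, j)\<close> being \<open>F i j\<close>;
  block indices start at \<open>0\<close>.\<close>

definition block_mat ::
  "nat \<Rightarrow> nat \<Rightarrow> nat \<Rightarrow> nat \<Rightarrow> (nat \<Rightarrow> nat \<Rightarrow> real mat) \<Rightarrow> real mat" where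
  "block_mat p q r c F =
     mat (p * r) (q * c) (\<lambda>(i, j). F (i div r) (j div c) $$ (i mod r, j mod c))"

definition observability_matrix :: "nat \<Rightarrow> real mat \<Rightarrow> real mat \<Rightarrow> real mat" where
  "observability_matrix s A C = block_mat s 1 (dim_row C) (dim_col C) (\<lambda>i j. C * A ^\<^sub>m i)"

definition controllability_matrix :: "nat \<Rightarrow> real mat \<Rightarrow> real mat \<Rightarrow> real mat" where
  "controllability_matrix s A B = block_mat 1 s (dim_row B) (dim_col B) (\<lambda>i j. A ^\<^sub>m j * B)"

definition observable :: "real mat \<Rightarrow> real mat \<Rightarrow> bool" where
  "observable A C \<longleftrightarrow> mat_rank (observability_matrix (dim_row A) A C) = dim_row A"

definition controllable :: "real mat \<Rightarrow> real mat \<Rightarrow> bool" where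
  "controllable A B \<longleftrightarrow> mat_rank (controllability_matrix (dim_row A) A B) = dim_row A"

text \<open>Prefix \<open>p\<close>: plant \<open>x(k+1) = A x(k) + B u\<^sup>a(k) + B\<^sub>d d(k)\<close>, \<open>y(k) = C x(k) + D\<^sub>d d(k)\<close>;
  prefix \<open>a\<close>: attack channels \<open>u\<^sup>a = u + B\<^sub>a a\<close>, \<open>y\<^sup>a = y + D\<^sub>a a\<close>;
  prefix \<open>c\<close>: controller \<open>x\<^sub>c(k+1) = A\<^sub>c x\<^sub>c(k) + B\<^sub>c (y\<^sub>r\<^sub>e\<^sub>f(k) - y\<^sup>a(k))\<close>,
  \<open>u(k) = C\<^sub>c x\<^sub>c(k) + D\<^sub>c (y\<^sub>r\<^sub>e\<^sub>f(k) - y\<^sup>a(k))\<close>.\<close>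

record attacked_loop =
  nx :: nat
  nu :: nat
  ny :: nat
  nd :: nat
  nc :: nat
  pA :: "real mat"
  pB :: "real mat"
  pC :: "real mat"
  pBd :: "real mat"
  pDd :: "real mat"
  aB :: "real mat"
  aD :: "real mat"
  cA :: "real mat"
  cB :: "real mat"
  cC :: "real mat"
  cD :: "real mat"

definition na :: "attacked_loop \<Rightarrow> nat" where
  "na S = nu S + ny S"

definition valid_loop :: "attacked_loop \<Rightarrow> bool" where
  "valid_loop S \<longleftrightarrow>
     pA S \<in> carrier_mat (nx S) (nx S) \<and> pB S \<in> carrier_mat (nx S) (nu S) \<and>
     pC S \<in> carrier_mat (ny S) (nx S) \<and>
     pBd S \<in> carrier_mat (nx S) (nd S) \<and> pDd S \<in> carrier_mat (ny S) (nd S) \<and>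
     aB S \<in> carrier_mat (nu S) (na S) \<and> aD S \<in> carrier_mat (ny S) (na S) \<and>
     cA S \<in> carrier_mat (nc S) (nc S) \<and> cB S \<in> carrier_mat (nc S) (ny S) \<and>
     cC S \<in> carrier_mat (nu S) (nc S) \<and> cD S \<in> carrier_mat (nu S) (ny S) \<and>
     observable (pA S) (pC S) \<and> controllable (pA S) (pB S)"

definition cl_A :: "attacked_loop \<Rightarrow> real mat" where
  "cl_A S = four_block_mat (pA S - pB S * cD S * pC S) (pB S * cC S) (- (cB S * pC S)) (cA S)"

definition cl_Ba :: "attacked_loop \<Rightarrow> real mat" where
  "cl_Ba S = (pB S * (aB S - cD S * aD S)) @\<^sub>r (- (cB S * aD S))"

definition cl_Bd :: "attacked_loop \<Rightarrow> real mat" where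
  "cl_Bd S = (pBd S - pB S * cD S * pDd S) @\<^sub>r (- (cB S * pDd S))"

definition markov_toeplitz ::
  "nat \<Rightarrow> real mat \<Rightarrow> real mat \<Rightarrow> real mat \<Rightarrow> real mat \<Rightarrow> real mat" where
  "markov_toeplitz s A B C D = block_mat s s (dim_row D) (dim_col D)
     (\<lambda>i j. if i = j then D
            else if j < i then C * A ^\<^sub>m (i - j - 1) * B
            else 0\<^sub>m (dim_row D) (dim_col D))"

definition Hd :: "attacked_loop \<Rightarrow> nat \<Rightarrow> real mat" where
  "Hd S s = markov_toeplitz s (pA S) (pBd S) (pC S) (pDd S)"

definition Ha :: "attacked_loop \<Rightarrow> nat \<Rightarrow> real mat" where
  "Ha S s = markov_toeplitz s (pA S) (pB S * aB S) (pC S) (aD S)"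

definition nres :: "attacked_loop \<Rightarrow> nat \<Rightarrow> nat" where
  "nres S s = s * ny S - nx S"

text \<open>\<open>G\<close> is the matrix commonly written \<open>\<Gamma>\<^sub>s\<^sup>\<bottom>\<close>. By observability \<open>nx S \<le> s * ny S\<close>
  whenever \<open>nx S \<le> s\<close>, so the subtraction in \<open>nres\<close> does not truncate.\<close>

definition obs_annihilator :: "attacked_loop \<Rightarrow> nat \<Rightarrow> real mat \<Rightarrow> bool" where
  "obs_annihilator S s G \<longleftrightarrow>
     G \<in> carrier_mat (nres S s) (s * ny S) \<and> full_row_rank G \<and>
     G * observability_matrix s (pA S) (pC S) = 0\<^sub>m (nres S s) (nx S)"

definition Wd :: "attacked_loop \<Rightarrow> nat \<Rightarrow> real mat \<Rightarrow> real mat" where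
  "Wd S s G = G * Hd S s"

definition Wa :: "attacked_loop \<Rightarrow> nat \<Rightarrow> real mat \<Rightarrow> real mat" where
  "Wa S s G = G * Ha S s"

definition Va_img :: "attacked_loop \<Rightarrow> nat \<Rightarrow> real mat \<Rightarrow> real mat" where
  "Va_img S s V = first_cols (nres S s) V"

definition Va_ker :: "attacked_loop \<Rightarrow> nat \<Rightarrow> real mat \<Rightarrow> real mat" where
  "Va_ker S s V = remaining_cols (nres S s) V"

definition nlift :: "attacked_loop \<Rightarrow> nat \<Rightarrow> nat" where
  "nlift S s = s * (nx S + nc S)"

text \<open>State of the lifted dynamics: \<open>s\<close> consecutive closed-loop states (plant and controller state
  deviation) stacked, the most recent one last.\<close>

definition lift_A :: "attacked_loop \<Rightarrow> nat \<Rightarrow> real mat" where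
  "lift_A S s = block_mat s s (nx S + nc S) (nx S + nc S)
     (\<lambda>i j. if j = s - 1 then cl_A S ^\<^sub>m (i + 1) else 0\<^sub>m (nx S + nc S) (nx S + nc S))"

definition lift_B :: "attacked_loop \<Rightarrow> nat \<Rightarrow> real mat \<Rightarrow> real mat" where
  "lift_B S s B = block_mat s s (nx S + nc S) (dim_col B)
     (\<lambda>i j. if j \<le> i then cl_A S ^\<^sub>m (i - j) * B else 0\<^sub>m (nx S + nc S) (dim_col B))"

definition lift_B_img :: "attacked_loop \<Rightarrow> nat \<Rightarrow> real mat \<Rightarrow> real mat" where
  "lift_B_img S s V = lift_B S s (cl_Ba S) * Va_img S s V"

definition lift_B_ker :: "attacked_loop \<Rightarrow> nat \<Rightarrow> real mat \<Rightarrow> real mat" where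
  "lift_B_ker S s V = lift_B S s (cl_Ba S) * Va_ker S s V"

text \<open>\<open>Wp\<close> stands for the Moore-Penrose inverse of \<open>Wa S s G\<close>.\<close>

definition lift_B_xi :: "attacked_loop \<Rightarrow> nat \<Rightarrow> real mat \<Rightarrow> real mat \<Rightarrow> real mat" where
  "lift_B_xi S s G Wp = lift_B S s (cl_Bd S) - lift_B S s (cl_Ba S) * Wp * Wd S s G"

definition lift_B_total ::
  "attacked_loop \<Rightarrow> nat \<Rightarrow> real mat \<Rightarrow> real mat \<Rightarrow> real mat \<Rightarrow> real mat" where
  "lift_B_total S s G Wp V = lift_B_img S s V @\<^sub>c lift_B_xi S s G Wp"

text \<open>The initial values \<open>x 0, \<dots>, x (s - 1)\<close> are arbitrary. The squared Euclidean norm of \<open>v\<close> is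
  \<open>v \<bullet> v\<close>.\<close>

definition admissible_trajectory ::
  "attacked_loop \<Rightarrow> nat \<Rightarrow> real mat \<Rightarrow> real mat \<Rightarrow> real mat \<Rightarrow> real mat \<Rightarrow> real mat \<Rightarrow>
   (nat \<Rightarrow> real vec) \<Rightarrow> bool" where
  "admissible_trajectory S s G Wp V P Q x \<longleftrightarrow>
     (\<forall>k. x k \<in> carrier_vec (nlift S s)) \<and>
     (\<exists>a_img a_ker \<xi>.
        (\<forall>i. a_img i \<in> carrier_vec (nres S s) \<and>
             a_ker i \<in> carrier_vec (s * na S - nres S s) \<and>
             \<xi> i \<in> carrier_vec (s * nd S)) \<and>
        (\<forall>k. x (k + s) =
               lift_A S s *\<^sub>v x k
               + lift_B_img S s V *\<^sub>v a_img (k + s - 1)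
               + lift_B_ker S s V *\<^sub>v a_ker (k + s - 1)
               + lift_B_xi S s G Wp *\<^sub>v \<xi> (k + s - 1)) \<and>
        (\<forall>i \<ge> 1.
           a_ker i = 0\<^sub>v (s * na S - nres S s) \<and>
           (let v = (P * Wa S s G * Va_img S s V) *\<^sub>v a_img i in v \<bullet> v \<le> 1) \<and>
           \<xi> i \<bullet> (Q *\<^sub>v \<xi> i) \<le> 1))"

definition Omega_bar ::
  "attacked_loop \<Rightarrow> nat \<Rightarrow> real mat \<Rightarrow> real mat \<Rightarrow> real mat \<Rightarrow> real mat \<Rightarrow> real \<Rightarrow> real \<Rightarrow> real mat"
where
  "Omega_bar S s G V P Q \<alpha>\<^sub>1 \<alpha>\<^sub>2 = diag_block_mat
     [(1 - \<alpha>\<^sub>1) \<cdot>\<^sub>m (transpose_mat (Va_img S s V) * transpose_mat (Wa S s G)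
                     * (transpose_mat P * P) * Wa S s G * Va_img S s V),
      (1 - \<alpha>\<^sub>2) \<cdot>\<^sub>m Q]"

definition lmi_matrix :: "real \<Rightarrow> real mat \<Rightarrow> real mat \<Rightarrow> real mat \<Rightarrow> real mat \<Rightarrow> real mat" where
  "lmi_matrix \<alpha> A B \<Omega> M =
     ((\<alpha> \<cdot>\<^sub>m M) @\<^sub>c 0\<^sub>m (dim_row M) (dim_col \<Omega>) @\<^sub>c (transpose_mat A * M)) @\<^sub>r
     (0\<^sub>m (dim_row \<Omega>) (dim_col M) @\<^sub>c \<Omega> @\<^sub>c (transpose_mat B * M)) @\<^sub>r
     ((M * A) @\<^sub>c (M * B) @\<^sub>c M)"

end

theory Submission
  imports Defs
begin

text \<open>
  The matrix inequality is a dissipation inequality in disguise. Evaluating its quadratic form at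
  \<open>(x, w, - (A x + B w))\<close> eliminates the third block row and leaves the bound
  \<open>\<parallel>A x + B w\<parallel>\<^sup>2 \<le> \<alpha> \<parallel>x\<parallel>\<^sup>2 + w \<bullet> \<Omega> w\<close>, where \<open>\<parallel>x\<parallel>\<^sup>2 = x \<bullet> M' x\<close> (\<open>lmi_dissipation\<close>). In the application \<open>w\<close>
  stacks the visible part of the attack and the disturbance. Stealthiness bounds the quadratic
  form of the first block by \<open>1 - \<alpha>\<^sub>1\<close>, the disturbance constraint that of the second by
  \<open>1 - \<alpha>\<^sub>2\<close>, so that \<open>w \<bullet> \<Omega> w \<le> 2 - \<alpha>\<close> because \<open>\<alpha>\<^sub>1 + \<alpha>\<^sub>2 \<ge> \<alpha>\<close>.

  The factor in \<open>M' = ((2 - \<alpha>) / (1 - \<alpha>)) M\<close> is chosen such that, in terms of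
  \<open>v k = x k \<bullet> M (x k)\<close>, this becomes the scalar recursion \<open>v (k + s) \<le> \<alpha> v k + (1 - \<alpha>)\<close>, whose
  fixed point is \<open>1\<close>. The excess \<open>v k - 1\<close> thus contracts by \<open>\<alpha>\<close> every \<open>s\<close> steps, along each of
  the \<open>s\<close> residue classes of time separately, and the limit superior is at most \<open>1\<close>
  (\<open>limsup_delayed_contraction\<close>).
\<close>

section \<open>Block matrices and quadratic forms\<close>

lemma append_cols_carrier:
  assumes "A \<in> carrier_mat r c1" and "B \<in> carrier_mat r c2"
  shows "A @\<^sub>c B \<in> carrier_mat r (c1 + c2)"
  using assms unfolding append_cols_def by auto

lemma append_cols_mult_vec:
  assumes A: "A \<in> carrier_mat r c1" and B: "B \<in> carrier_mat r c2"
    and x: "x \<in> carrier_vec c1" and y: "y \<in> carrier_vec c2"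
  shows "(A @\<^sub>c B) *\<^sub>v (x @\<^sub>v y) = A *\<^sub>v x + B *\<^sub>v y"
proof -
  have "(A @\<^sub>c B) *\<^sub>v (x @\<^sub>v y) =
      (A *\<^sub>v x + B *\<^sub>v y) @\<^sub>v (0\<^sub>m 0 c1 *\<^sub>v x + 0\<^sub>m 0 c2 *\<^sub>v y)"
    using A B unfolding append_cols_def
    by (subst four_block_mat_mult_vec[OF A B _ _ x y]) auto
  also have "\<dots> = A *\<^sub>v x + B *\<^sub>v y"
    using A B by (intro eq_vecI) auto
  finally show ?thesis .
qed

lemma smult_mat_quadratic_form:
  fixes x :: "real vec"
  assumes M: "M \<in> carrier_mat n n" and x: "x \<in> carrier_vec n"
  shows "x \<bullet> ((c \<cdot>\<^sub>m M) *\<^sub>v x) = c * (x \<bullet> (M *\<^sub>v x))"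
proof -
  have "(c \<cdot>\<^sub>m M) *\<^sub>v x = c \<cdot>\<^sub>v (M *\<^sub>v x)"
    using M x by (intro eq_vecI) auto
  then show ?thesis using M x by auto
qed

lemma gram_quadratic_form:
  fixes x :: "real vec"
  assumes N: "N \<in> carrier_mat m n" and x: "x \<in> carrier_vec n"
  shows "x \<bullet> ((transpose_mat N * N) *\<^sub>v x) = (N *\<^sub>v x) \<bullet> (N *\<^sub>v x)"
proof -
  have "x \<bullet> ((transpose_mat N * N) *\<^sub>v x) = (transpose_mat N *\<^sub>v (N *\<^sub>v x)) \<bullet> x"
    using N x by (subst comm_scalar_prod[of _ n]) auto
  also have "\<dots> = (N *\<^sub>v x) \<bullet> (N *\<^sub>v x)"
    using N x by (intro transpose_vec_mult_scalar) auto
  finally show ?thesis .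
qed

lemma diag_block_mat_two_quadratic_form:
  fixes a b :: "real vec"
  assumes A: "A \<in> carrier_mat m m" and B: "B \<in> carrier_mat n n"
    and a: "a \<in> carrier_vec m" and b: "b \<in> carrier_vec n"
  shows "(a @\<^sub>v b) \<bullet> (diag_block_mat [A, B] *\<^sub>v (a @\<^sub>v b)) =
    a \<bullet> (A *\<^sub>v a) + b \<bullet> (B *\<^sub>v b)"
proof -
  have "diag_block_mat [A, B] = four_block_mat A (0\<^sub>m m n) (0\<^sub>m n m) B"
    unfolding diag_block_mat.simps(2)[of A "[B]"] diag_block_mat_singleton Let_def
    using A B by simp
  then have "diag_block_mat [A, B] *\<^sub>v (a @\<^sub>v b) = (A *\<^sub>v a) @\<^sub>v (B *\<^sub>v b)"
    using mult_mat_vec_split[OF A B a b] by simp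
  then show ?thesis
    using A B a b by (simp add: scalar_prod_append[of _ m _ n])
qed

section \<open>The matrix inequality as a dissipation inequality\<close>

text \<open>The choice \<open>z = - (A x + B w)\<close> minimises the quadratic form of the block matrix over its
  last argument when \<open>M\<close> is positive definite;
  substituting it is a Schur complement step that never inverts \<open>M\<close>.\<close>

lemma lmi_dissipation:
  assumes A: "A \<in> carrier_mat n n" and B: "B \<in> carrier_mat n m"
    and \<Omega>: "\<Omega> \<in> carrier_mat m m" and M: "M \<in> carrier_mat n n"
    and psd: "pos_semidef (lmi_matrix \<alpha> A B \<Omega> M)"
    and x: "x \<in> carrier_vec n" and w: "w \<in> carrier_vec m"
  shows "(A *\<^sub>v x + B *\<^sub>v w) \<bullet> (M *\<^sub>v (A *\<^sub>v x + B *\<^sub>v w))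
           \<le> \<alpha> * (x \<bullet> (M *\<^sub>v x)) + w \<bullet> (\<Omega> *\<^sub>v w)"
proof -
  define y where "y = A *\<^sub>v x + B *\<^sub>v w"
  have y: "y \<in> carrier_vec n" using A B x w unfolding y_def by auto
  define z where "z = - y"
  have z: "z \<in> carrier_vec n" using y unfolding z_def by auto
  have Mz: "M *\<^sub>v z \<in> carrier_vec n" using M z by auto
  have zero: "0\<^sub>m n m *\<^sub>v w = 0\<^sub>v n" "0\<^sub>m m n *\<^sub>v x = 0\<^sub>v m"
    using x w by (auto intro!: eq_vecI)
  let ?u = "x @\<^sub>v (w @\<^sub>v z)"
  have wz: "w @\<^sub>v z \<in> carrier_vec (m + n)" using w z by auto
  have u: "?u \<in> carrier_vec (n + (m + n))" using x wz by auto
  let ?R1 = "(\<alpha> \<cdot>\<^sub>m M) @\<^sub>c 0\<^sub>m n m @\<^sub>c (transpose_mat A * M)"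
  let ?R2 = "0\<^sub>m m n @\<^sub>c \<Omega> @\<^sub>c (transpose_mat B * M)"
  let ?R3 = "(M * A) @\<^sub>c (M * B) @\<^sub>c M"
  have L: "lmi_matrix \<alpha> A B \<Omega> M = ?R1 @\<^sub>r ?R2 @\<^sub>r ?R3"
    using M \<Omega> unfolding lmi_matrix_def by simp
  have R1: "?R1 \<in> carrier_mat n (n + (m + n))"
    using A M by (intro append_cols_carrier) auto
  have R2: "?R2 \<in> carrier_mat m (n + (m + n))"
    using B M \<Omega> by (intro append_cols_carrier) auto
  have R3: "?R3 \<in> carrier_mat n (n + (m + n))"
    using A B M by (intro append_cols_carrier) auto
  have R23: "?R2 @\<^sub>r ?R3 \<in> carrier_mat (m + n) (n + (m + n))"
    using R2 R3 by auto
  have r1: "?R1 *\<^sub>v ?u = (\<alpha> \<cdot>\<^sub>m M) *\<^sub>v x + (0\<^sub>m n m *\<^sub>v w + (transpose_mat A * M) *\<^sub>v z)"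
    using A M x w z wz
    by (simp add: append_cols_mult_vec[of _ n n _ "m + n"] append_cols_mult_vec[of _ n m _ n]
        append_cols_carrier[of _ n m _ n] del: assoc_mult_mat_vec)
  have r2: "?R2 *\<^sub>v ?u = 0\<^sub>m m n *\<^sub>v x + (\<Omega> *\<^sub>v w + (transpose_mat B * M) *\<^sub>v z)"
    using B M \<Omega> x w z wz
    by (simp add: append_cols_mult_vec[of _ m n _ "m + n"] append_cols_mult_vec[of _ m m _ n]
        append_cols_carrier[of _ m m _ n] del: assoc_mult_mat_vec)
  have r3: "?R3 *\<^sub>v ?u = (M * A) *\<^sub>v x + ((M * B) *\<^sub>v w + M *\<^sub>v z)"
    using A B M x w z wz
    by (simp add: append_cols_mult_vec[of _ n n _ "m + n"] append_cols_mult_vec[of _ n m _ n]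
        append_cols_carrier[of _ n m _ n] del: assoc_mult_mat_vec)
  have dim: "dim_row (lmi_matrix \<alpha> A B \<Omega> M) = n + (m + n)"
    unfolding L using R1 R23 by (metis carrier_append_rows carrier_matD(1))
  have "0 \<le> ?u \<bullet> (lmi_matrix \<alpha> A B \<Omega> M *\<^sub>v ?u)"
    using psd u unfolding pos_semidef_def dim by blast
  also have "lmi_matrix \<alpha> A B \<Omega> M *\<^sub>v ?u = (?R1 *\<^sub>v ?u) @\<^sub>v ((?R2 *\<^sub>v ?u) @\<^sub>v (?R3 *\<^sub>v ?u))"
    unfolding L mat_mult_append[OF R1 R23 u] mat_mult_append[OF R2 R3 u] ..
  also have "?u \<bullet> \<dots> = x \<bullet> (?R1 *\<^sub>v ?u) + (w \<bullet> (?R2 *\<^sub>v ?u) + z \<bullet> (?R3 *\<^sub>v ?u))"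
    using R1 R2 R3 u x w z
    by (subst scalar_prod_append[of _ n _ "m + n"], simp, simp, simp, simp,
        subst scalar_prod_append[of _ m _ n]) auto
  also have "x \<bullet> (?R1 *\<^sub>v ?u) = \<alpha> * (x \<bullet> (M *\<^sub>v x)) + (A *\<^sub>v x) \<bullet> (M *\<^sub>v z)"
  proof -
    have "x \<bullet> (?R1 *\<^sub>v ?u) = x \<bullet> ((\<alpha> \<cdot>\<^sub>m M) *\<^sub>v x) + x \<bullet> (transpose_mat A *\<^sub>v (M *\<^sub>v z))"
    proof -
      have "(\<alpha> \<cdot>\<^sub>m M) *\<^sub>v x \<in> carrier_vec n"
        using smult_carrier_mat[OF M] x by (rule mult_mat_vec_carrier)
      moreover have "transpose_mat A *\<^sub>v (M *\<^sub>v z) \<in> carrier_vec n"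
        using A M z by (intro mult_mat_vec_carrier[of _ n n]) auto
      ultimately show ?thesis
        using A M x z unfolding r1 by (simp add: zero scalar_prod_add_distrib[of _ n])
    qed
    also have "x \<bullet> (transpose_mat A *\<^sub>v (M *\<^sub>v z)) = (A *\<^sub>v x) \<bullet> (M *\<^sub>v z)"
      using transpose_vec_mult_scalar[OF A x Mz] A M x z Mz
      by (metis comm_scalar_prod mult_mat_vec_carrier transpose_carrier_mat)
    finally show ?thesis using smult_mat_quadratic_form[OF M x] by simp
  qed
  also have "w \<bullet> (?R2 *\<^sub>v ?u) = w \<bullet> (\<Omega> *\<^sub>v w) + (B *\<^sub>v w) \<bullet> (M *\<^sub>v z)"
  proof -
    have "w \<bullet> (?R2 *\<^sub>v ?u) = w \<bullet> (\<Omega> *\<^sub>v w) + w \<bullet> (transpose_mat B *\<^sub>v (M *\<^sub>v z))"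
      using B M \<Omega> x w z unfolding r2
      by (simp add: zero scalar_prod_add_distrib[of _ m])
    also have "w \<bullet> (transpose_mat B *\<^sub>v (M *\<^sub>v z)) = (B *\<^sub>v w) \<bullet> (M *\<^sub>v z)"
      using transpose_vec_mult_scalar[OF B w Mz] B M w z Mz
      by (metis comm_scalar_prod mult_mat_vec_carrier transpose_carrier_mat)
    finally show ?thesis .
  qed
  also have "z \<bullet> (?R3 *\<^sub>v ?u) = 0"
  proof -
    have "?R3 *\<^sub>v ?u = M *\<^sub>v (y + z)"
      using A B M x w y z unfolding r3
      by (simp add: y_def mult_add_distrib_mat_vec[of _ n n] assoc_add_vec[of _ n])
    moreover have "y + z = 0\<^sub>v n" using y unfolding z_def by auto
    moreover have "M *\<^sub>v 0\<^sub>v n = 0\<^sub>v n" using M by (intro eq_vecI) auto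
    ultimately show ?thesis using z by simp
  qed
  finally have "0 \<le> \<alpha> * (x \<bullet> (M *\<^sub>v x)) + w \<bullet> (\<Omega> *\<^sub>v w)
      + ((A *\<^sub>v x) \<bullet> (M *\<^sub>v z) + (B *\<^sub>v w) \<bullet> (M *\<^sub>v z))"
    by simp
  also have "(A *\<^sub>v x) \<bullet> (M *\<^sub>v z) + (B *\<^sub>v w) \<bullet> (M *\<^sub>v z) = y \<bullet> (M *\<^sub>v z)"
    using A B x w Mz unfolding y_def by (simp add: add_scalar_prod_distrib[of _ n])
  also have "M *\<^sub>v z = - (M *\<^sub>v y)"
    using M y unfolding z_def by (intro eq_vecI) auto
  also have "y \<bullet> (- (M *\<^sub>v y)) = - (y \<bullet> (M *\<^sub>v y))"
    using M y by simp
  finally show ?thesis unfolding y_def by simp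
qed

section \<open>Contraction with delay\<close>

text \<open>The recursion couples only indices in the same residue class modulo \<open>s\<close>; a common constant
  \<open>C\<close> for the first \<open>s\<close> values starts all classes at once.\<close>

lemma limsup_delayed_contraction:
  fixes v :: "nat \<Rightarrow> real" and a b :: real
  assumes s: "0 < s" and a: "0 \<le> a" "a < 1"
    and step: "\<And>k. 1 \<le> k \<Longrightarrow> v (k + s) \<le> a * v k + (1 - a) * b"
  shows "limsup (\<lambda>k. ereal (v k)) \<le> ereal b"
proof -
  define C where "C = (\<Sum>j<s. \<bar>v (Suc j) - b\<bar>)"
  have C: "v (Suc j) - b \<le> C" if "j < s" for j
  proof -
    have "v (Suc j) - b \<le> \<bar>v (Suc j) - b\<bar>" by simp
    also have "\<dots> \<le> C" unfolding C_def by (rule member_le_sum) (use that in auto)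
    finally show ?thesis .
  qed
  have excess: "v (Suc k) - b \<le> a ^ (k div s) * C" for k
  proof (induction k rule: less_induct)
    case (less k)
    show ?case
    proof (cases "k < s")
      case True
      then show ?thesis using C by simp
    next
      case False
      define j where "j = k - s"
      have k: "k = j + s" and "j < k" using False s unfolding j_def by auto
      have "v (Suc k) - b \<le> a * (v (Suc j) - b)"
        using step[of "Suc j"] k by (simp add: algebra_simps)
      also have "\<dots> \<le> a * (a ^ (j div s) * C)"
        using less[OF \<open>j < k\<close>] a by (intro mult_left_mono) auto
      also have "\<dots> = a ^ (k div s) * C" using s k by simp
      finally show ?thesis .
    qed
  qed
  have "filterlim (\<lambda>k. (k - 1) div s) at_top sequentially"
    unfolding filterlim_at_top
  proof
    fix N
    show "\<forall>\<^sub>F k in sequentially. N \<le> (k - 1) div s"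
      by (rule eventually_sequentiallyI[of "N * s + 1"])
        (use s in \<open>simp add: less_eq_div_iff_mult_less_eq\<close>)
  qed
  with LIMSEQ_power_zero[of a] a have "(\<lambda>k. a ^ ((k - 1) div s)) \<longlonglongrightarrow> 0"
    by (auto intro: filterlim_compose)
  then have "(\<lambda>k. b + a ^ ((k - 1) div s) * C) \<longlonglongrightarrow> b + 0 * C"
    by (intro tendsto_intros)
  then have lim: "(\<lambda>k. ereal (b + a ^ ((k - 1) div s) * C)) \<longlonglongrightarrow> ereal b" by simp
  have "v k \<le> b + a ^ ((k - 1) div s) * C" if "1 \<le> k" for k
    using excess[of "k - 1"] that by simp
  then have "limsup (\<lambda>k. ereal (v k)) \<le> limsup (\<lambda>k. ereal (b + a ^ ((k - 1) div s) * C))"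
    by (intro Limsup_mono eventually_sequentiallyI[of 1]) simp
  also have "\<dots> = ereal b"
    by (rule lim_imp_Limsup[OF _ lim]) simp
  finally show ?thesis .
qed

section \<open>The lifted closed loop\<close>

lemma lift_B_carrier:
  "B \<in> carrier_mat r c \<Longrightarrow> lift_B S s B \<in> carrier_mat (nlift S s) (s * c)"
  unfolding lift_B_def block_mat_def nlift_def by simp

lemma lift_A_carrier: "lift_A S s \<in> carrier_mat (nlift S s) (nlift S s)"
  unfolding lift_A_def block_mat_def nlift_def by simp

lemma cl_Ba_carrier:
  assumes "valid_loop S"
  shows "cl_Ba S \<in> carrier_mat (nx S + nc S) (na S)"
  using assms unfolding cl_Ba_def valid_loop_def by (intro carrier_append_rows) auto

lemma cl_Bd_carrier:
  assumes "valid_loop S"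
  shows "cl_Bd S \<in> carrier_mat (nx S + nc S) (nd S)"
  using assms unfolding cl_Bd_def valid_loop_def by (intro carrier_append_rows) auto

lemma Wa_carrier:
  assumes "valid_loop S" and "obs_annihilator S s G"
  shows "Wa S s G \<in> carrier_mat (nres S s) (s * na S)"
  using assms
  unfolding valid_loop_def obs_annihilator_def Wa_def Ha_def markov_toeplitz_def block_mat_def
  by auto

lemma Wd_carrier:
  assumes "valid_loop S" and "obs_annihilator S s G"
  shows "Wd S s G \<in> carrier_mat (nres S s) (s * nd S)"
  using assms
  unfolding valid_loop_def obs_annihilator_def Wd_def Hd_def markov_toeplitz_def block_mat_def
  by auto

text \<open>The first block of \<open>\<Omega>\<close> is the Gram matrix of \<open>P W\<^sub>a V\<^sub>a\<close>, so its quadratic form is the squared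
  residual that stealthiness bounds.\<close>

lemma Omega_bar_quadratic_form:
  assumes W: "Wa S s G \<in> carrier_mat (nres S s) (s * na S)"
    and V: "Va_img S s V \<in> carrier_mat (s * na S) (nres S s)"
    and P: "P \<in> carrier_mat r (nres S s)"
    and Q: "Q \<in> carrier_mat (s * nd S) (s * nd S)"
    and a: "a \<in> carrier_vec (nres S s)" and d: "d \<in> carrier_vec (s * nd S)"
  defines "N \<equiv> P * Wa S s G * Va_img S s V"
  shows "(a @\<^sub>v d) \<bullet> (Omega_bar S s G V P Q \<alpha>\<^sub>1 \<alpha>\<^sub>2 *\<^sub>v (a @\<^sub>v d)) =
    (1 - \<alpha>\<^sub>1) * ((N *\<^sub>v a) \<bullet> (N *\<^sub>v a)) + (1 - \<alpha>\<^sub>2) * (d \<bullet> (Q *\<^sub>v d))"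
proof -
  let ?W = "Wa S s G" and ?V = "Va_img S s V"
  let ?p = "nres S s" and ?q = "s * na S"
  have PW: "P * ?W \<in> carrier_mat r ?q" using P W by auto
  have N: "N \<in> carrier_mat r ?p" using PW V unfolding N_def by auto
  let ?X = "transpose_mat ?V * transpose_mat ?W"
  have X: "?X \<in> carrier_mat ?p ?p" using W V by auto
  have Pt: "transpose_mat P \<in> carrier_mat ?p r" using P by auto
  have XPt: "?X * transpose_mat P \<in> carrier_mat ?p r" using X Pt by auto
  have "transpose_mat N = transpose_mat ?V * (transpose_mat ?W * transpose_mat P)"
    unfolding N_def using transpose_mult[OF PW V] transpose_mult[OF P W] by simp
  also have "\<dots> = ?X * transpose_mat P"
    using P W V by (intro assoc_mult_mat[symmetric]) auto
  finally have Nt: "transpose_mat N = ?X * transpose_mat P" .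
  have gram: "?X * (transpose_mat P * P) * ?W * ?V = transpose_mat N * N"
    unfolding Nt unfolding N_def
      assoc_mult_mat[OF X Pt P, symmetric] assoc_mult_mat[OF XPt P W] assoc_mult_mat[OF XPt PW V] ..
  have NN: "transpose_mat N * N \<in> carrier_mat ?p ?p" using N by auto
  show ?thesis
    unfolding Omega_bar_def gram
    using NN Q a d
    by (simp only: diag_block_mat_two_quadratic_form[OF smult_carrier_mat smult_carrier_mat]
        smult_mat_quadratic_form[OF NN a] smult_mat_quadratic_form[OF Q d]
        gram_quadratic_form[OF N a])
qed

lemma Omega_bar_carrier:
  assumes "Va_img S s V \<in> carrier_mat (s * na S) (nres S s)"
    and "Q \<in> carrier_mat (s * nd S) (s * nd S)"
  shows "Omega_bar S s G V P Q \<alpha>\<^sub>1 \<alpha>\<^sub>2 \<in> carrier_mat (nres S s + s * nd S) (nres S s + s * nd S)"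
  using assms unfolding Omega_bar_def by (auto simp: Let_def)

section \<open>The asymptotic ellipsoid\<close>

theorem theorem1:
  fixes S :: attacked_loop
    and s n\<^sub>r :: nat
    and G Wp U L V P Q M M' :: "real mat"
    and \<alpha> \<alpha>\<^sub>1 \<alpha>\<^sub>2 :: real
  assumes "valid_loop S"
    and "nx S \<le> s"
    and "obs_annihilator S s G"
    and "full_row_rank (Wa S s G)"
    and "moore_penrose_inverse (Wa S s G) Wp"
    and "is_svd (Wa S s G) U L V"
    and "P \<in> carrier_mat n\<^sub>r (nres S s)" and "pos_def (transpose_mat P * P)"
    and "Q \<in> carrier_mat (s * nd S) (s * nd S)" and "pos_def Q"
    and "0 < \<alpha>" and "\<alpha> < 1"
    and "M \<in> carrier_mat (nlift S s) (nlift S s)" and "symmetric_matrix M"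
    and "M' \<in> carrier_mat (nlift S s) (nlift S s)" and "symmetric_matrix M'"
    and "M' = ((2 - \<alpha>) / (1 - \<alpha>)) \<cdot>\<^sub>m M" and "pos_def M'"
    and "\<alpha>\<^sub>1 + \<alpha>\<^sub>2 \<ge> \<alpha>"
    and "0 \<le> \<alpha>\<^sub>1" and "\<alpha>\<^sub>1 \<le> 1" and "0 \<le> \<alpha>\<^sub>2" and "\<alpha>\<^sub>2 \<le> 1"
    and "pos_semidef (lmi_matrix \<alpha> (lift_A S s) (lift_B_total S s G Wp V)
           (Omega_bar S s G V P Q \<alpha>\<^sub>1 \<alpha>\<^sub>2) M')"
  shows "\<forall>x. admissible_trajectory S s G Wp V P Q x \<longrightarrow>
           limsup (\<lambda>k. ereal (x k \<bullet> (M *\<^sub>v x k))) \<le> 1"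
proof (intro allI impI)
  fix x
  assume adm: "admissible_trajectory S s G Wp V P Q x"
  note M = \<open>M \<in> carrier_mat (nlift S s) (nlift S s)\<close>
    and M' = \<open>M' \<in> carrier_mat (nlift S s) (nlift S s)\<close>
    and P = \<open>P \<in> carrier_mat n\<^sub>r (nres S s)\<close>
    and Q = \<open>Q \<in> carrier_mat (s * nd S) (s * nd S)\<close>
  have W: "Wa S s G \<in> carrier_mat (nres S s) (s * na S)"
    using Wa_carrier assms(1,3) .
  have "V \<in> carrier_mat (s * na S) (s * na S)"
    using \<open>is_svd (Wa S s G) U L V\<close> W unfolding is_svd_def by auto
  then have Vi: "Va_img S s V \<in> carrier_mat (s * na S) (nres S s)"
    and Vk: "Va_ker S s V \<in> carrier_mat (s * na S) (s * na S - nres S s)"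
    unfolding Va_img_def Va_ker_def first_cols_def remaining_cols_def by auto
  have LBa: "lift_B S s (cl_Ba S) \<in> carrier_mat (nlift S s) (s * na S)"
    using lift_B_carrier[OF cl_Ba_carrier[OF assms(1)]] .
  have Bi: "lift_B_img S s V \<in> carrier_mat (nlift S s) (nres S s)"
    using LBa Vi unfolding lift_B_img_def by auto
  have Bk: "lift_B_ker S s V \<in> carrier_mat (nlift S s) (s * na S - nres S s)"
    using LBa Vk unfolding lift_B_ker_def by auto
  have Bx: "lift_B_xi S s G Wp \<in> carrier_mat (nlift S s) (s * nd S)"
    using LBa Wd_carrier[OF assms(1,3)] unfolding lift_B_xi_def by auto
  have B: "lift_B_total S s G Wp V \<in> carrier_mat (nlift S s) (nres S s + s * nd S)"
    unfolding lift_B_total_def using Bi Bx by (rule append_cols_carrier)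
  have x: "x k \<in> carrier_vec (nlift S s)" for k
    using adm unfolding admissible_trajectory_def by auto
  obtain a_img a_ker \<xi> where
    ai: "\<And>i. a_img i \<in> carrier_vec (nres S s)"
    and \<xi>: "\<And>i. \<xi> i \<in> carrier_vec (s * nd S)"
    and dyn: "\<And>k. x (k + s) = lift_A S s *\<^sub>v x k + lift_B_img S s V *\<^sub>v a_img (k + s - 1)
               + lift_B_ker S s V *\<^sub>v a_ker (k + s - 1) + lift_B_xi S s G Wp *\<^sub>v \<xi> (k + s - 1)"
    and ker0: "\<And>i. 1 \<le> i \<Longrightarrow> a_ker i = 0\<^sub>v (s * na S - nres S s)"
    and stealth: "\<And>i. 1 \<le> i \<Longrightarrow> ((P * Wa S s G * Va_img S s V) *\<^sub>v a_img i) \<bullet>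
               ((P * Wa S s G * Va_img S s V) *\<^sub>v a_img i) \<le> 1"
    and dist: "\<And>i. 1 \<le> i \<Longrightarrow> \<xi> i \<bullet> (Q *\<^sub>v \<xi> i) \<le> 1"
    using adm unfolding admissible_trajectory_def Let_def by blast
  define c where "c = (2 - \<alpha>) / (1 - \<alpha>)"
  have c: "0 < c" "2 - \<alpha> = c * (1 - \<alpha>)"
    using \<open>\<alpha> < 1\<close> unfolding c_def by auto
  have weight: "y \<bullet> (M' *\<^sub>v y) = c * (y \<bullet> (M *\<^sub>v y))" if "y \<in> carrier_vec (nlift S s)" for y
    using smult_mat_quadratic_form[OF M that] assms(17) unfolding c_def by simp
  show "limsup (\<lambda>k. ereal (x k \<bullet> (M *\<^sub>v x k))) \<le> 1"
  proof (cases "s = 0")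
    case True
    \<comment> \<open>The recursion is no recursion here, but the lifted state space has dimension \<open>0\<close>.\<close>
    then have "x k \<bullet> (M *\<^sub>v x k) = 0" for k
      using x[of k] M unfolding nlift_def by (simp add: scalar_prod_def)
    then show ?thesis by (simp add: Limsup_const)
  next
    case False
    have "x (k + s) \<bullet> (M *\<^sub>v x (k + s)) \<le> \<alpha> * (x k \<bullet> (M *\<^sub>v x k)) + (1 - \<alpha>) * 1"
      if "1 \<le> k" for k
    proof -
      define i where "i = k + s - 1"
      \<comment> \<open>The input index of the step from \<open>k = 0\<close> with \<open>s = 1\<close> would be \<open>0\<close>, where the inputs are
        unconstrained.\<close>
      have i: "1 \<le> i" using that False unfolding i_def by simp
      let ?w = "a_img i @\<^sub>v \<xi> i"
      have w: "?w \<in> carrier_vec (nres S s + s * nd S)" using ai \<xi> by auto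
      have Ax: "lift_A S s *\<^sub>v x k \<in> carrier_vec (nlift S s)"
        using lift_A_carrier[of S s] x by auto
      have "lift_B_ker S s V *\<^sub>v 0\<^sub>v (s * na S - nres S s) = 0\<^sub>v (nlift S s)"
        using Bk by (intro eq_vecI) auto
      then have "x (k + s) =
          lift_A S s *\<^sub>v x k + (lift_B_img S s V *\<^sub>v a_img i + lift_B_xi S s G Wp *\<^sub>v \<xi> i)"
        using dyn[of k] ker0[OF i] Ax Bi Bx ai[of i] \<xi>[of i]
        unfolding i_def[symmetric] by (simp add: assoc_add_vec[of _ "nlift S s"])
      also have "\<dots> = lift_A S s *\<^sub>v x k + lift_B_total S s G Wp V *\<^sub>v ?w"
        unfolding lift_B_total_def append_cols_mult_vec[OF Bi Bx ai \<xi>] ..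
      finally have "x (k + s) \<bullet> (M' *\<^sub>v x (k + s))
          \<le> \<alpha> * (x k \<bullet> (M' *\<^sub>v x k)) + ?w \<bullet> (Omega_bar S s G V P Q \<alpha>\<^sub>1 \<alpha>\<^sub>2 *\<^sub>v ?w)"
        using lmi_dissipation[OF lift_A_carrier B Omega_bar_carrier[OF Vi Q] M' assms(24) x w]
        by simp
      also have "?w \<bullet> (Omega_bar S s G V P Q \<alpha>\<^sub>1 \<alpha>\<^sub>2 *\<^sub>v ?w) \<le> (1 - \<alpha>\<^sub>1) * 1 + (1 - \<alpha>\<^sub>2) * 1"
        unfolding Omega_bar_quadratic_form[OF W Vi P Q ai \<xi>]
        using stealth[OF i] dist[OF i] \<open>\<alpha>\<^sub>1 \<le> 1\<close> \<open>\<alpha>\<^sub>2 \<le> 1\<close>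
        by (intro add_mono mult_left_mono) auto
      also have "\<dots> \<le> c * (1 - \<alpha>)"
        using \<open>\<alpha>\<^sub>1 + \<alpha>\<^sub>2 \<ge> \<alpha>\<close> c(2) by simp
      finally have "c * (x (k + s) \<bullet> (M *\<^sub>v x (k + s)))
          \<le> c * (\<alpha> * (x k \<bullet> (M *\<^sub>v x k)) + (1 - \<alpha>) * 1)"
        using weight[OF x] by (simp add: algebra_simps)
      then show ?thesis using c(1) by simp
    qed
    then have "limsup (\<lambda>k. ereal (x k \<bullet> (M *\<^sub>v x k))) \<le> ereal 1"
      using False \<open>0 < \<alpha>\<close> \<open>\<alpha> < 1\<close> by (intro limsup_delayed_contraction[of s \<alpha>]) auto
    then show ?thesis by (simp add: one_ereal_def)
  qed
qed

end
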